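(* Let $\mathcal{D}_n$ be a dataset, $\Xi$ a finite index set, $\{\widehat f^{\xi}:\xi\in\Xi\}$ prediction procedures, $\ell:\mathbb{R}\times\mathbb{R}\to\mathbb{R}_{\ge 0}$ a loss function, and let $\widehat f^{\mathrm{cv}}(\cdot;\mathcal{D}_n)$ be the output of the split-sample cross-validation procedure described in the context. Define $$\Delta_n^{\mathrm{add}}=\max_{\xi\in\Xi}\big|\widehat R(\widehat f^{\xi}(\cdot;\mathcal{D}_{\mathrm{tr}}))-R(\widehat f^{\xi}(\cdot;\mathcal{D}_{\mathrm{tr}}))\big|,\qquad \Delta_n^{\mathrm{mul}}=\max_{\xi\in\Xi}\left|\frac{\widehat R(\widehat f^{\xi}(\cdot;\mathcal{D}_{\mathrm{tr}}))}{R(\widehat f^{\xi}(\cdot;\mathcal{D}_{\mathrm{tr}}))}-1\right|.$$ Then the following hold. 1. (Additive form) $$R(\widehat f^{\mathrm{cv}}(\cdot;\mathcal{D}_n))\le\min_{\xi\in\Xi}R(\widehat f^{\xi}(\cdot;\mathcal{D}_{\mathrm{tr}}))+2\Delta_n^{\mathrm{add}},$$ $$\mathbb{E}[R(\widehat f^{\mathrm{cv}}(\cdot;\mathcal{D}_n))]\le\min_{\xi\in\Xi}\mathbb{E}[R(\widehat f^{\xi}(\cdot;\mathcal{D}_{\mathrm{tr}}))]+2\,\mathbb{E}[\Delta_n^{\mathrm{add}}].$$ 2. (Multiplicative form) $$R(\widehat f^{\mathrm{cv}}(\cdot;\mathcal{D}_n))\le\frac{1+\Delta_n^{\mathrm{mul}}}{(1-\Delta_n^{\mathrm{mul}})_+}\cdot\min_{\xi\in\Xi}R(\widehat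 f^{\xi}(\cdot;\mathcal{D}_{\mathrm{tr}})).$$
   Context: A dataset is $\mathcal{D}_n=\{(X_i,Y_i)\in\mathbb{R}^p\times\mathbb{R}:1\le i\le n\}$. A prediction procedure $\widehat f$ maps a dataset $\mathcal{D}$ to a predictor $\widehat f(\cdot;\mathcal{D}):\mathbb{R}^p\to\mathbb{R}$. The conditional prediction risk of a predictor is $R(\widehat f(\cdot;\mathcal{D}))=\int\ell(y,\widehat f(x;\mathcal{D}))\,dP(x,y)$, where $P$ is the distribution of a fresh pair $(X_0,Y_0)$ independent of $\mathcal{D}_n$; it is a random variable depending on $\mathcal D$. Split-sample cross-validation: fix an integer $1\le n_{\mathrm{te}}<n$. Split $\{1,\dots,n\}$ randomly into disjoint $\mathcal{I}_{\mathrm{tr}}$ with $|\mathcal{I}_{\mathrm{tr}}|=n_{\mathrm{tr}}=n-n_{\mathrm{te}}$ and $\mathcal{I}_{\mathrm{te}}$ with $|\mathcal{I}_{\mathrm{te}}|=n_{\mathrm{te}}$, and let $\mathcal{D}_{\mathrm{tr}},\mathcal{D}_{\mathrm{te}}$ be the corresponding parts of $\mathcal{D}_n$. For each $\xi\in\Xi$ fit $\widehat f^{\xi}(\cdot;\mathcal{D}_{\mathrm{tr}})$ and compute the risk estimate $\widehat R(\widehat f^{\xi}(\cdot;\mathcal{D}_{\mathrm{tr}}))$, which is either the average of the values $\ell(Y_j,\widehat f^{\xi}(X_j;\mathcal{D}_{\mathrm{tr}}))$, $j\in\mathcal{I}_{\mathrm{te}}$, or the median-of-means of these values with parameter $\eta\in(0,1)$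 (split the values into $B=\lceil 8\log(1/\eta)\rceil$ batches, average in each batch, take the median of the batch averages). Let $\widehat\xi\in\arg\min_{\xi\in\Xi}\widehat R(\widehat f^{\xi}(\cdot;\mathcal{D}_{\mathrm{tr}}))$ (any minimizer) and $\widehat f^{\mathrm{cv}}(\cdot;\mathcal{D}_n)=\widehat f^{\widehat\xi}(\cdot;\mathcal{D}_{\mathrm{tr}})$. Here $(a)_+=\max\{a,0\}$. In the multiplicative form the risks $R(\widehat f^{\xi}(\cdot;\mathcal{D}_{\mathrm{tr}}))$ are positive so that $\Delta_n^{\mathrm{mul}}$ is defined, and the right-hand side is read as $+\infty$ if $(1-\Delta_n^{\mathrm{mul}})_+=0$. No assumption is made on the distribution of or dependence between the observations. *)

theory Defs
  imports "HOL-Probability.Probability" "HOL-Library.Disjoint_Sets"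
begin

type_synonym 'p obs = "(real ^ 'p) \<times> real"
type_synonym 'p predictor = "real ^ 'p \<Rightarrow> real"

text \<open>A dataset is a list of observations, not a set, so that repeated observations are kept.\<close>

type_synonym 'p procedure = "'p obs list \<Rightarrow> 'p predictor"

text \<open>Joint measurability in dataset and feature vector. Datasets of size \<open>m\<close> carry the product
  \<open>\<sigma>\<close>-algebra, transported from functions on \<open>{..<m}\<close> since lists have no library \<open>\<sigma>\<close>-algebra.\<close>

definition measurable_procedure :: "('p::finite) procedure \<Rightarrow> bool" where
  "measurable_procedure f \<longleftrightarrow>
     (\<forall>m. (\<lambda>(D, x). f (map D [0..<m]) x)
            \<in> borel_measurable ((\<Pi>\<^sub>M j\<in>{..<m}. (borel :: 'p obs measure)) \<Otimes>\<^sub>M borel))"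

definition subdataset :: "(nat \<Rightarrow> 'p obs) \<Rightarrow> nat set \<Rightarrow> 'p obs list" where
  "subdataset z I = map z (sorted_list_of_set I)"

text \<open>The risk is extended-valued, so that no integrability of the loss is presupposed.\<close>

definition risk :: "('p::finite) obs measure \<Rightarrow> (real \<Rightarrow> real \<Rightarrow> real) \<Rightarrow> 'p predictor \<Rightarrow> ennreal" where
  "risk P loss g = (\<integral>\<^sup>+ (x, y). ennreal (loss y (g x)) \<partial>P)"

definition avg_loss ::
    "(nat \<Rightarrow> 'p obs) \<Rightarrow> (real \<Rightarrow> real \<Rightarrow> real) \<Rightarrow> nat set \<Rightarrow> 'p predictor \<Rightarrow> real" where
  "avg_loss z loss J g = (\<Sum>j\<in>J. loss (snd (z j)) (g (fst (z j)))) / real (card J)"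

text \<open>For an even number of values the median is the midpoint of the two middle ones.\<close>

definition median :: "real multiset \<Rightarrow> real" where
  "median A = (let s = sorted_list_of_multiset A; k = size A
               in (s ! ((k - 1) div 2) + s ! (k div 2)) / 2)"

definition median_of_means ::
    "(nat \<Rightarrow> 'p obs) \<Rightarrow> (real \<Rightarrow> real \<Rightarrow> real) \<Rightarrow> nat set set \<Rightarrow> 'p predictor \<Rightarrow> real" where
  "median_of_means z loss \<B> g = median (image_mset (\<lambda>J. avg_loss z loss J g) (mset_set \<B>))"

text \<open>Since subtraction on \<^typ>\<open>ennreal\<close> truncates at 0, this is \<open>\<bar>a - b\<bar>\<close>.\<close>

definition ennreal_dist :: "ennreal \<Rightarrow> ennreal \<Rightarrow> ennreal" where
  "ennreal_dist a b = max (a - b) (b - a)"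

definition delta_add :: "'i set \<Rightarrow> ('i \<Rightarrow> real) \<Rightarrow> ('i \<Rightarrow> ennreal) \<Rightarrow> ennreal" where
  "delta_add \<Xi> Rhat R = (MAX \<xi>\<in>\<Xi>. ennreal_dist (ennreal (Rhat \<xi>)) (R \<xi>))"

definition delta_mul :: "'i set \<Rightarrow> ('i \<Rightarrow> real) \<Rightarrow> ('i \<Rightarrow> ennreal) \<Rightarrow> ennreal" where
  "delta_mul \<Xi> Rhat R = (MAX \<xi>\<in>\<Xi>. ennreal_dist (ennreal (Rhat \<xi>) / R \<xi>) 1)"

text \<open>The factor \<open>(1 + \<Delta>) / (1 - \<Delta>)\<^sub>+\<close>: on \<^typ>\<open>ennreal\<close> the term \<open>1 - \<Delta>\<close> is already the positive
  part, and dividing a nonzero number by 0 gives \<open>\<infinity>\<close>.\<close>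

definition mul_factor :: "ennreal \<Rightarrow> ennreal" where
  "mul_factor \<Delta> = (1 + \<Delta>) / (1 - \<Delta>)"

end

theory Submission
  imports Defs
begin

text \<open>
  Both pointwise inequalities are deterministic. Let \<open>h\<close> minimise over \<open>\<Xi>\<close> the estimates \<open>a\<close> of the
  true values \<open>b\<close>. If every estimate is within \<open>\<Delta>\<close> of its target, then for each competitor \<open>\<xi>\<close>

  \<open>b h \<le> a h + \<Delta> \<le> a \<xi> + \<Delta> \<le> b \<xi> + 2 \<Delta>\<close>,

  and if every ratio \<open>a / b\<close> is within \<open>\<Delta> < 1\<close> of \<open>1\<close>, then

  \<open>(1 - \<Delta>) b h \<le> a h \<le> a \<xi> \<le> (1 + \<Delta>) b \<xi>\<close>.

  These are \<open>argmin_le_add\<close> and \<open>argmin_le_mul\<close>. They see the estimates only through the minimality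
  of \<open>h\<close> and through \<open>\<Delta>\<close>, so one argument covers the average and the median of means. An infinite
  risk makes \<open>\<Delta>\<close> infinite in the additive case and at least \<open>1\<close> in the multiplicative case, so it
  leaves both bounds true with right-hand side \<open>\<infinity>\<close>.

  The bound in expectation comes from integrating \<open>b h \<le> b \<xi> + 2 \<Delta>\<close> for one fixed \<open>\<xi>\<close> and minimising
  over \<open>\<xi>\<close> afterwards. Splitting the integral of the sum is the only step that concerns
  measurability, and for an upper bound it is enough that one summand is measurable
  (\<open>nn_integral_add_cmult_le\<close>). That summand is the risk of a fixed procedure trained on the random
  subsample: once the index set is fixed, it is a partial integral of a jointly measurable function
  (\<open>measurable_risk_random_subdataset\<close>).
\<close>

section \<open>Selecting the minimiser of an approximation\<close>

lemma le_add_ennreal_dist: "a \<le> b + ennreal_dist a b"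
  and le_add_ennreal_dist': "b \<le> a + ennreal_dist a b"
proof -
  have "a - b \<le> ennreal_dist a b" "b - a \<le> ennreal_dist a b"
    by (simp_all add: ennreal_dist_def)
  then show "a \<le> b + ennreal_dist a b" "b \<le> a + ennreal_dist a b"
    by (simp_all add: ennreal_minus_le_iff)
qed

lemma ennreal_divide_mult_cancel:
  fixes a b :: ennreal
  shows "b \<noteq> 0 \<Longrightarrow> b \<noteq> \<top> \<Longrightarrow> a / b * b = a"
  by (simp add: ennreal_divide_times less_top)

lemma ennreal_dist_le_delta_add:
  "finite \<Xi> \<Longrightarrow> \<xi> \<in> \<Xi> \<Longrightarrow> ennreal_dist (ennreal (a \<xi>)) (b \<xi>) \<le> delta_add \<Xi> a b"
  unfolding delta_add_def by (rule Max_ge) auto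

lemma ennreal_dist_le_delta_mul:
  "finite \<Xi> \<Longrightarrow> \<xi> \<in> \<Xi> \<Longrightarrow> ennreal_dist (ennreal (a \<xi>) / b \<xi>) 1 \<le> delta_mul \<Xi> a b"
  unfolding delta_mul_def by (rule Max_ge) auto

text \<open>The error is paid twice: for underestimating the selected value and for overestimating the
  value of the competitor.\<close>

lemma argmin_le_add:
  assumes "finite \<Xi>" and "is_arg_min a (\<lambda>\<xi>. \<xi> \<in> \<Xi>) h" and "\<xi> \<in> \<Xi>"
  shows "b h \<le> b \<xi> + 2 * delta_add \<Xi> a b"
proof -
  let ?\<Delta> = "delta_add \<Xi> a b"
  have h: "h \<in> \<Xi>" and min: "a h \<le> a \<xi>"
    using assms(2,3) by (auto simp: is_arg_min_linorder)
  have "b h \<le> ennreal (a h) + ennreal_dist (ennreal (a h)) (b h)"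
    by (rule le_add_ennreal_dist')
  also have "\<dots> \<le> ennreal (a \<xi>) + ?\<Delta>"
    using min assms(1) h by (intro add_mono ennreal_leI ennreal_dist_le_delta_add)
  also have "\<dots> \<le> (b \<xi> + ennreal_dist (ennreal (a \<xi>)) (b \<xi>)) + ?\<Delta>"
    by (intro add_right_mono le_add_ennreal_dist)
  also have "\<dots> \<le> (b \<xi> + ?\<Delta>) + ?\<Delta>"
    using assms(1,3) by (intro add_right_mono add_left_mono ennreal_dist_le_delta_add)
  finally show ?thesis
    by (simp add: mult_2 add.assoc)
qed

text \<open>The relative error is controlled by clearing denominators, which is legitimate only for finite
  positive \<open>b\<close>. An infinite \<open>b \<xi>\<close> has \<open>a \<xi> / b \<xi> = 0\<close>, at distance \<open>1\<close> from \<open>1\<close>, so \<open>\<Delta> < 1\<close>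
  excludes it; for \<open>\<Delta> \<ge> 1\<close> the factor is infinite.\<close>

lemma argmin_le_mul:
  assumes fin: "finite \<Xi>" and argmin: "is_arg_min a (\<lambda>\<xi>. \<xi> \<in> \<Xi>) h" and \<xi>: "\<xi> \<in> \<Xi>"
    and pos: "\<And>\<zeta>. \<zeta> \<in> \<Xi> \<Longrightarrow> 0 < b \<zeta>"
  shows "b h \<le> mul_factor (delta_mul \<Xi> a b) * b \<xi>"
proof -
  let ?\<Delta> = "delta_mul \<Xi> a b"
  have h: "h \<in> \<Xi>" and min: "a h \<le> a \<xi>"
    using argmin \<xi> by (auto simp: is_arg_min_linorder)
  show ?thesis
  proof (cases "1 - ?\<Delta> = 0")
    case True
    then have "mul_factor ?\<Delta> = \<top>"
      by(simp add: mul_factor_def)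
    then show ?thesis
      using pos[OF \<xi>] by (simp add: ennreal_top_mult)
  next
    case False
    have b_fin: "b \<zeta> \<noteq> \<top>" if "\<zeta> \<in> \<Xi>" for \<zeta>
    proof
      assume "b \<zeta> = \<top>"
      then have "1 \<le> ?\<Delta>"
        using ennreal_dist_le_delta_mul[OF fin that, of a b] by (simp add: ennreal_dist_def)
      with False show False
        by (simp add: diff_eq_0_iff_ennreal)
    qed
    have ratio: "ennreal (a \<zeta>) / b \<zeta> * b \<zeta> = ennreal (a \<zeta>)" if "\<zeta> \<in> \<Xi>" for \<zeta>
      using pos[OF that] b_fin[OF that] by (intro ennreal_divide_mult_cancel) auto
    have "1 \<le> ennreal (a h) / b h + ?\<Delta>"
      by (rule order_trans[OF le_add_ennreal_dist'[of 1 "ennreal (a h) / b h"]])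
         (intro add_left_mono ennreal_dist_le_delta_mul fin h)
    then have "1 - ?\<Delta> \<le> ennreal (a h) / b h"
      by (simp add: ennreal_minus_le_iff add.commute)
    then have "(1 - ?\<Delta>) * b h \<le> ennreal (a h) / b h * b h"
      by (rule mult_right_mono) simp
    also have "\<dots> = ennreal (a h)"
      by (rule ratio[OF h])
    also have "\<dots> \<le> ennreal (a \<xi>)"
      using min by (rule ennreal_leI)
    also have "\<dots> = ennreal (a \<xi>) / b \<xi> * b \<xi>"
      by (rule ratio[OF \<xi>, symmetric])
    also have "\<dots> \<le> (1 + ?\<Delta>) * b \<xi>"
    proof (rule mult_right_mono)
      show "ennreal (a \<xi>) / b \<xi> \<le> 1 + ?\<Delta>"
        by (rule order_trans[OF le_add_ennreal_dist[of _ 1]])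
           (intro add_left_mono ennreal_dist_le_delta_mul fin \<xi>)
    qed simp
    finally have bound: "(1 - ?\<Delta>) * b h \<le> (1 + ?\<Delta>) * b \<xi>" .
    have "b h = b h * (1 - ?\<Delta>) / (1 - ?\<Delta>)"
      using False by (simp add: mult_divide_eq_ennreal)
    also have "\<dots> = (1 - ?\<Delta>) * b h / (1 - ?\<Delta>)"
      by (simp only: mult.commute)
    also have "\<dots> \<le> (1 + ?\<Delta>) * b \<xi> / (1 - ?\<Delta>)"
      by (rule divide_right_mono_ennreal[OF bound])
    finally show ?thesis
      by (simp add: mul_factor_def ennreal_divide_times ennreal_times_divide[symmetric])
  qed
qed

section \<open>Splitting the integral of a sum\<close>

text \<open>The integral of an arbitrary function is the supremum over the simple functions below it. Any
  simple \<open>s \<le> u + c v\<close> leaves, after removal of \<open>u\<close> and scaling, the measurable function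
  \<open>(s - u) / c \<le> v\<close>; this is why \<open>v\<close> may be arbitrary.\<close>

lemma nn_integral_add_cmult_le:
  fixes c :: ennreal
  assumes u: "u \<in> borel_measurable M" and c: "0 < c" "c < \<top>"
  shows "(\<integral>\<^sup>+ x. u x + c * v x \<partial>M) \<le> (\<integral>\<^sup>+ x. u x \<partial>M) + c * (\<integral>\<^sup>+ x. v x \<partial>M)"
  unfolding nn_integral_def[of M "\<lambda>x. u x + c * v x"]
proof (rule SUP_least)
  fix s assume "s \<in> {g. simple_function M g \<and> g \<le> (\<lambda>x. u x + c * v x)}"
  then have s: "simple_function M s" and le: "\<And>x. s x \<le> u x + c * v x"
    by (auto simp: le_fun_def)
  have sm: "s \<in> borel_measurable M"
    by (rule borel_measurable_simple_function[OF s])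
  \<comment> \<open>Where \<open>u\<close> is infinite, \<open>s - u\<close> could be \<open>\<infinity> - \<infinity> = \<infinity>\<close>, so the remainder is set to \<open>0\<close> there.\<close>
  define w where "w x = (if u x = \<top> then 0 else (s x - u x) / c)" for x
  have wm: "w \<in> borel_measurable M"
    unfolding w_def using u sm by measurable
  have w_le: "w x \<le> v x" for x
  proof (cases "u x = \<top>")
    case False
    then have "s x - u x \<le> c * v x"
      using le[of x] by (simp add: ennreal_minus_le_iff)
    then have "(s x - u x) / c \<le> c * v x / c"
      by (rule divide_right_mono_ennreal)
    also have "\<dots> = v x"
      using c mult_divide_eq_ennreal[of c "v x"] by (simp add: mult.commute)
    finally show ?thesis
      using False by (simp add: w_def)
  qed (simp add: w_def)
  have s_le: "s x \<le> u x + c * w x" for x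
  proof (cases "u x = \<top>")
    case False
    then have "c * w x = s x - u x"
      using c ennreal_divide_mult_cancel[of c "s x - u x"] by (simp add: w_def mult.commute)
    then show ?thesis
      using False ennreal_minus_le_iff[of "s x" "u x" "c * w x"] by simp
  qed simp
  have "integral\<^sup>S M s = (\<integral>\<^sup>+ x. s x \<partial>M)"
    by (rule nn_integral_eq_simple_integral[OF s, symmetric])
  also have "\<dots> \<le> (\<integral>\<^sup>+ x. u x + c * w x \<partial>M)"
    by (intro nn_integral_mono s_le)
  also have "\<dots> = (\<integral>\<^sup>+ x. u x \<partial>M) + c * (\<integral>\<^sup>+ x. w x \<partial>M)"
    using u wm by (simp add: nn_integral_add nn_integral_cmult)
  also have "\<dots> \<le> (\<integral>\<^sup>+ x. u x \<partial>M) + c * (\<integral>\<^sup>+ x. v x \<partial>M)"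
    by (intro add_left_mono mult_left_mono nn_integral_mono w_le) simp
  finally show "integral\<^sup>S M s \<le> (\<integral>\<^sup>+ x. u x \<partial>M) + c * (\<integral>\<^sup>+ x. v x \<partial>M)" .
qed

section \<open>Measurability of the risk on a random subsample\<close>

text \<open>Joint measurability of the procedure makes the risk of the predictor trained on an array
  \<open>D \<in> {..<m} \<rightarrow> obs\<close> a partial integral of a jointly measurable function of \<open>D\<close> and the fresh
  observation.\<close>

lemma measurable_risk_PiM:
  fixes f :: "('p::finite) procedure" and P :: "'p obs measure"
  assumes P: "prob_space P" "sets P = sets borel"
    and f: "measurable_procedure f"
    and loss: "(\<lambda>(y, y'). loss y y') \<in> borel_measurable borel"
  shows "(\<lambda>D. risk P loss (f (map D [0..<m])))
           \<in> borel_measurable (\<Pi>\<^sub>M j\<in>{..<m}. (borel :: 'p obs measure))"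
proof -
  let ?Q = "\<Pi>\<^sub>M j\<in>{..<m}. (borel :: 'p obs measure)"
  interpret P: prob_space P by fact
  have fst_m: "(\<lambda>q. fst (snd q)) \<in> measurable (?Q \<Otimes>\<^sub>M P) (borel :: (real^'p) measure)"
    and snd_m: "(\<lambda>q. snd (snd q)) \<in> measurable (?Q \<Otimes>\<^sub>M P) (borel :: real measure)"
    using P(2) by (auto intro!: measurable_compose[OF measurable_snd] 
       simp: measurable_cong_sets[OF P(2) refl] borel_prod[symmetric])
  have "(\<lambda>q. (fst q, fst (snd q))) \<in> measurable (?Q \<Otimes>\<^sub>M P) (?Q \<Otimes>\<^sub>M borel)"
    using fst_m by measurable
  from measurable_compose[OF this f[unfolded measurable_procedure_def, rule_format, of m]]
  have pred: "(\<lambda>q. f (map (fst q) [0..<m]) (fst (snd q))) \<in> borel_measurable (?Q \<Otimes>\<^sub>M P)"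
    by simp
  have "(\<lambda>q. (snd (snd q), f (map (fst q) [0..<m]) (fst (snd q))))
          \<in> measurable (?Q \<Otimes>\<^sub>M P) (borel :: (real \<times> real) measure)"
    using snd_m pred by (rule borel_measurable_Pair)
  from measurable_compose[OF this loss]
  have "(\<lambda>(D, xy). ennreal (loss (snd xy) (f (map D [0..<m]) (fst xy))))
          \<in> borel_measurable (?Q \<Otimes>\<^sub>M P)"
    by (simp add: case_prod_beta)
  from P.borel_measurable_nn_integral[OF this] show ?thesis
    by (simp add: risk_def split_beta')
qed

lemma measurable_risk_subdataset:
  fixes f :: "('p::finite) procedure" and P :: "'p obs measure"
  assumes P: "prob_space P" "sets P = sets borel"
    and f: "measurable_procedure f"
    and loss: "(\<lambda>(y, y'). loss y y') \<in> borel_measurable borel"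
    and Z: "\<And>i. i \<in> I \<Longrightarrow> (\<lambda>\<omega>. Z \<omega> i) \<in> borel_measurable M"
    and I: "finite I"
  shows "(\<lambda>\<omega>. risk P loss (f (subdataset (Z \<omega>) I))) \<in> borel_measurable M"
proof -
  define xs where "xs = sorted_list_of_set I"
  have set_xs: "set xs = I"
    using I by (simp add: xs_def)
  have arr: "(\<lambda>\<omega>. \<lambda>j\<in>{..<length xs}. Z \<omega> (xs ! j))
               \<in> measurable M (\<Pi>\<^sub>M j\<in>{..<length xs}. borel)"
    using set_xs nth_mem[of _ xs] by (intro measurable_restrict Z) auto
  have "subdataset (Z \<omega>) I = map (\<lambda>j\<in>{..<length xs}. Z \<omega> (xs ! j)) [0..<length xs]" for \<omega>
    by (rule nth_equalityI) (simp_all add: subdataset_def flip: xs_def)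
  then show ?thesis
    using measurable_compose[OF arr measurable_risk_PiM[OF P f loss]] by simp
qed

text \<open>Only countably many index sets occur, so the previous lemma can be applied on each event on which
  the index set is constant.\<close>

lemma measurable_risk_random_subdataset:
  fixes f :: "('p::finite) procedure" and P :: "'p obs measure"
  assumes P: "prob_space P" "sets P = sets borel"
    and f: "measurable_procedure f"
    and loss: "(\<lambda>(y, y'). loss y y') \<in> borel_measurable borel"
    and I: "I \<in> measurable M (count_space \<I>)"
    and \<I>: "countable \<I>" "\<And>J. J \<in> \<I> \<Longrightarrow> finite J"
    and Z: "\<And>i. i \<in> \<Union>\<I> \<Longrightarrow> (\<lambda>\<omega>. Z \<omega> i) \<in> borel_measurable M"
  shows "(\<lambda>\<omega>. risk P loss (f (subdataset (Z \<omega>) (I \<omega>)))) \<in> borel_measurable M"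
proof (rule measurable_compose_countable'[OF _ I \<I>(1)])
  fix J assume "J \<in> \<I>"
  then show "(\<lambda>\<omega>. risk P loss (f (subdataset (Z \<omega>) J))) \<in> borel_measurable M"
    by (intro measurable_risk_subdataset[OF P f loss] Z \<I>(2)) auto
qed

section \<open>The oracle inequalities\<close>

theorem proposition2p1:
  fixes M :: "'a measure"
    and n n_te :: nat
    and X :: "nat \<Rightarrow> 'a \<Rightarrow> real ^ 'p"
    and Y :: "nat \<Rightarrow> 'a \<Rightarrow> real"
    and Z :: "'a \<Rightarrow> nat \<Rightarrow> 'p obs"
    and P :: "'p obs measure"
    and \<Xi> :: "'i set"
    and f :: "'i \<Rightarrow> 'p procedure"
    and loss :: "real \<Rightarrow> real \<Rightarrow> real"
    and I_tr I_te :: "'a \<Rightarrow> nat set"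
    and D_tr :: "'a \<Rightarrow> 'p obs list"
    and Rhat :: "'i \<Rightarrow> 'a \<Rightarrow> real"
    and R :: "'i \<Rightarrow> 'a \<Rightarrow> ennreal"
    and \<xi>_hat :: "'a \<Rightarrow> 'i"
    and f_cv :: "'a \<Rightarrow> 'p predictor"
  assumes "prob_space M"
    and "1 \<le> n_te" and "n_te < n"
    and "\<And>i. i \<in> {1..n} \<Longrightarrow> X i \<in> borel_measurable M"
    and "\<And>i. i \<in> {1..n} \<Longrightarrow> Y i \<in> borel_measurable M"
    and "\<And>\<omega> i. Z \<omega> i = (X i \<omega>, Y i \<omega>)"
    and "prob_space P" and "sets P = sets borel"
    and "finite \<Xi>" and "\<Xi> \<noteq> {}"
    and "\<And>\<xi>. \<xi> \<in> \<Xi> \<Longrightarrow> measurable_procedure (f \<xi>)"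
    and "\<And>y y'. 0 \<le> loss y y'"
    and "(\<lambda>(y, y'). loss y y') \<in> borel_measurable borel"
    and "I_tr \<in> measurable M (count_space {I. I \<subseteq> {1..n} \<and> card I = n - n_te})"
    and "\<And>\<omega>. I_te \<omega> = {1..n} - I_tr \<omega>"
    and "\<And>\<omega>. D_tr \<omega> = subdataset (Z \<omega>) (I_tr \<omega>)"
    and "(\<forall>\<omega>\<in>space M. \<forall>\<xi>\<in>\<Xi>. Rhat \<xi> \<omega> = avg_loss (Z \<omega>) loss (I_te \<omega>) (f \<xi> (D_tr \<omega>))) \<or>
         (\<exists>(\<eta>::real) \<B>. 0 < \<eta> \<and> \<eta> < 1 \<and>
            \<B> \<in> measurable M (count_space (Pow (Pow {1..n}))) \<and>
            (\<forall>\<omega>\<in>space M. partition_on (I_te \<omega>) (\<B> \<omega>) \<and>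
                           card (\<B> \<omega>) = nat \<lceil>8 * ln (1 / \<eta>)\<rceil>) \<and>
            (\<forall>\<omega>\<in>space M. \<forall>\<xi>\<in>\<Xi>.
               Rhat \<xi> \<omega> = median_of_means (Z \<omega>) loss (\<B> \<omega>) (f \<xi> (D_tr \<omega>))))"
    and "\<And>\<xi> \<omega>. R \<xi> \<omega> = risk P loss (f \<xi> (D_tr \<omega>))"
    and "\<And>\<omega>. \<omega> \<in> space M \<Longrightarrow> is_arg_min (\<lambda>\<xi>. Rhat \<xi> \<omega>) (\<lambda>\<xi>. \<xi> \<in> \<Xi>) (\<xi>_hat \<omega>)"
    and "\<And>\<omega>. f_cv \<omega> = f (\<xi>_hat \<omega>) (D_tr \<omega>)"
  shows "(\<forall>\<omega>\<in>space M. risk P loss (f_cv \<omega>)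
             \<le> (MIN \<xi>\<in>\<Xi>. R \<xi> \<omega>) + 2 * delta_add \<Xi> (\<lambda>\<xi>. Rhat \<xi> \<omega>) (\<lambda>\<xi>. R \<xi> \<omega>)) \<and>
         (\<integral>\<^sup>+ \<omega>. risk P loss (f_cv \<omega>) \<partial>M)
             \<le> (MIN \<xi>\<in>\<Xi>. \<integral>\<^sup>+ \<omega>. R \<xi> \<omega> \<partial>M)
               + 2 * (\<integral>\<^sup>+ \<omega>. delta_add \<Xi> (\<lambda>\<xi>. Rhat \<xi> \<omega>) (\<lambda>\<xi>. R \<xi> \<omega>) \<partial>M) \<and>
         (\<forall>\<omega>\<in>space M. (\<forall>\<xi>\<in>\<Xi>. 0 < R \<xi> \<omega>) \<longrightarrow>
             risk P loss (f_cv \<omega>)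
             \<le> mul_factor (delta_mul \<Xi> (\<lambda>\<xi>. Rhat \<xi> \<omega>) (\<lambda>\<xi>. R \<xi> \<omega>)) * (MIN \<xi>\<in>\<Xi>. R \<xi> \<omega>))"
proof -
  note fin = assms(9) and ne = assms(10) and argmin = assms(19)
  have risk_cv: "risk P loss (f_cv \<omega>) = R (\<xi>_hat \<omega>) \<omega>" for \<omega>
    by (simp add: assms(18,20))
  let ?\<Delta> = "\<lambda>\<omega>. delta_add \<Xi> (\<lambda>\<xi>. Rhat \<xi> \<omega>) (\<lambda>\<xi>. R \<xi> \<omega>)"
  have add: "risk P loss (f_cv \<omega>) \<le> R \<xi> \<omega> + 2 * ?\<Delta> \<omega>"
    if "\<omega> \<in> space M" "\<xi> \<in> \<Xi>" for \<omega> \<xi>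
    using argmin_le_add[OF fin argmin[OF that(1)] that(2)] by (simp add: risk_cv)

  have min_attained: "\<exists>\<xi>\<in>\<Xi>. (MIN \<xi>\<in>\<Xi>. g \<xi>) = g \<xi>" for g :: "'i \<Rightarrow> ennreal"
  proof -
    have "Min (g ` \<Xi>) \<in> g ` \<Xi>"
      using fin ne by (intro Min_in) auto
    then show ?thesis
      by (rule imageE) blast
  qed

  have pointwise_add: "risk P loss (f_cv \<omega>) \<le> (MIN \<xi>\<in>\<Xi>. R \<xi> \<omega>) + 2 * ?\<Delta> \<omega>"
    if "\<omega> \<in> space M" for \<omega>
    using min_attained[of "\<lambda>\<xi>. R \<xi> \<omega>"] add[OF that] by auto

  have Z_meas: "(\<lambda>\<omega>. Z \<omega> i) \<in> borel_measurable M" if "i \<in> {1..n}" for i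
    unfolding assms(6) using assms(4,5)[OF that] by (rule borel_measurable_Pair)
  have R_meas: "R \<xi> \<in> borel_measurable M" if "\<xi> \<in> \<Xi>" for \<xi>
  proof -
    have "(\<lambda>\<omega>. risk P loss (f \<xi> (subdataset (Z \<omega>) (I_tr \<omega>)))) \<in> borel_measurable M"
    proof (rule measurable_risk_random_subdataset[OF assms(7,8) assms(11)[OF that] assms(13,14)])
      show "countable {I. I \<subseteq> {1..n} \<and> card I = n - n_te}"
        by (rule countable_finite, rule finite_subset[of _ "Pow {1..n}"]) auto
      show "finite J" if "J \<in> {I. I \<subseteq> {1..n} \<and> card I = n - n_te}" for J
        using that finite_subset[of J "{1..n}"] by simp
      show "(\<lambda>\<omega>. Z \<omega> i) \<in> borel_measurable M"
        if "i \<in> \<Union>{I. I \<subseteq> {1..n} \<and> card I = n - n_te}" for i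
        using that by (intro Z_meas) blast
    qed
    moreover have "R \<xi> = (\<lambda>\<omega>. risk P loss (f \<xi> (subdataset (Z \<omega>) (I_tr \<omega>))))"
      by (rule ext) (simp add: assms(16,18))
    ultimately show ?thesis
      by simp
  qed

  have mean_add: "(\<integral>\<^sup>+ \<omega>. risk P loss (f_cv \<omega>) \<partial>M)
      \<le> (MIN \<xi>\<in>\<Xi>. \<integral>\<^sup>+ \<omega>. R \<xi> \<omega> \<partial>M) + 2 * (\<integral>\<^sup>+ \<omega>. ?\<Delta> \<omega> \<partial>M)"
  proof -
    obtain \<xi> where \<xi>: "\<xi> \<in> \<Xi>"
      and min: "(MIN \<xi>\<in>\<Xi>. \<integral>\<^sup>+ \<omega>. R \<xi> \<omega> \<partial>M) = (\<integral>\<^sup>+ \<omega>. R \<xi> \<omega> \<partial>M)"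
      using min_attained[of "\<lambda>\<xi>. \<integral>\<^sup>+ \<omega>. R \<xi> \<omega> \<partial>M"] by auto
    have "(\<integral>\<^sup>+ \<omega>. risk P loss (f_cv \<omega>) \<partial>M) \<le> (\<integral>\<^sup>+ \<omega>. R \<xi> \<omega> + 2 * ?\<Delta> \<omega> \<partial>M)"
      by (intro nn_integral_mono add \<xi>)
    also have "\<dots> \<le> (\<integral>\<^sup>+ \<omega>. R \<xi> \<omega> \<partial>M) + 2 * (\<integral>\<^sup>+ \<omega>. ?\<Delta> \<omega> \<partial>M)"
      by (rule nn_integral_add_cmult_le[OF R_meas[OF \<xi>]]) (simp_all add: ennreal_numeral_less_top)
    finally show ?thesis
      unfolding min .
  qed

  have pointwise_mul: "risk P loss (f_cv \<omega>)
      \<le> mul_factor (delta_mul \<Xi> (\<lambda>\<xi>. Rhat \<xi> \<omega>) (\<lambda>\<xi>. R \<xi> \<omega>)) * (MIN \<xi>\<in>\<Xi>. R \<xi> \<omega>)"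
    if "\<omega> \<in> space M" "\<forall>\<xi>\<in>\<Xi>. 0 < R \<xi> \<omega>" for \<omega>
  proof -
    obtain \<xi> where \<xi>: "\<xi> \<in> \<Xi>" and min: "(MIN \<xi>\<in>\<Xi>. R \<xi> \<omega>) = R \<xi> \<omega>"
      using min_attained[of "\<lambda>\<xi>. R \<xi> \<omega>"] by auto
    show ?thesis
      unfolding min risk_cv
      using argmin_le_mul[OF fin argmin[OF that(1)] \<xi>, of "\<lambda>\<xi>. R \<xi> \<omega>"] that(2) by simp
  qed

  show ?thesis
    using pointwise_add mean_add pointwise_mul by blast
qed

end
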